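(* Let $N>1$, $p_{10},p_{01}\in(0,1)$ with $p_{10}+p_{01}<1$, and consider the saturated $N$-queue system with one-slot switchover delay and Gilbert-Elliot channels with transition probabilities $p_{10},p_{01}$. The Greedy Myopic (GM) policy achieves the sum-rate upper bound; that is, with $C_0^{(N)}=\frac{p_{10}^N}{(p_{10}+p_{01})^N}$, the time average expected departure rates $r_1,\dots,r_N$ under the GM policy satisfy $$\sum_{i=1}^N r_i=1-C_0^{(N)}-\Big(p_{10}\big(1-C_0^{(N)}\big)-p_{01}C_0^{(N)}\Big),$$ the right-hand side being an upper bound on the sum-rate of any policy in the saturated system.
   Context: Saturated system (all $N$ queues always nonempty): time is slotted; the state in slot $t$ is $(m(t),C_1(t),\dots,C_N(t))$, where $m(t)\in\{1,\dots,N\}$ is the queue at which the server is located and $C_i(t)\in\{0,1\}$ is the channel state of queue $i$ ($1$ = ON, $0$ = OFF). The $C_i$ are independent two-state Markov chains, unaffected by the actions, each with transition probability $p_{10}$ from ON to OFF and $p_{01}$ from OFF to ON. In each slot the server, observing the state, chooses the queue $a_t\in\{1,\dots,N\}$ at which it will be present in the next slot: $m(t+1)=a_t$. One packet departs from queue $i$ in slot $t$ if and only if $m(t)=i$, $C_i(t)=1$ and $a_t=i$. The rate $r_i$ of queue $i$ is the long-run time average expected number of departures per slot from queue $i$. Greedy Myopic (GM) policy: in every slot $t$, if $C_{m(t)}(t)=1$, serve queue $m(t)$ (i.e. $a_t=m(t)$). Otherwise, if there is $j\ne m(t)$ with $C_j(t)=1$, then among the queues with ON channel switch to the first one in the cyclic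 order $m(t)+1,\dots,N,1,\dots,m(t)-1$. If no channel is ON, the server stays at its current queue. *)

theory Defs
  imports "HOL-Probability.Probability"
begin

text \<open>
  A state \<open>(m, C)\<close> consists of the queue \<open>m\<close> at which the server is located and the channel
  states \<open>C\<close>, where \<open>C i\<close> means that channel \<open>i\<close> is ON. Queues are the numbers \<open>1, \<dots>, N\<close>; the
  value of \<open>C\<close> outside this range carries no information and is fixed to \<open>False\<close>.
\<close>

type_synonym state = "nat \<times> (nat \<Rightarrow> bool)"

definition states :: "nat \<Rightarrow> state set" where
  "states N = {1..N} \<times> {C. \<forall>i. i \<notin> {1..N} \<longrightarrow> \<not> C i}"

definition next_channels :: "nat \<Rightarrow> real \<Rightarrow> real \<Rightarrow> (nat \<Rightarrow> bool) \<Rightarrow> (nat \<Rightarrow> bool) pmf" where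
  "next_channels N p10 p01 C =
     Pi_pmf {1..N} False (\<lambda>i. bernoulli_pmf (if C i then 1 - p10 else p01))"

text \<open>
  A policy maps the observed history to a distribution over the next location of the server, so
  history-dependent, time-dependent and randomized policies are all included. Histories list the
  states in reverse chronological order: the head is the current state. Past actions need not be
  recorded separately, since the action of a slot is the server location in the next one.
\<close>

type_synonym policy = "state list \<Rightarrow> nat pmf"

definition admissible :: "nat \<Rightarrow> policy \<Rightarrow> bool" where
  "admissible N \<pi> \<longleftrightarrow> (\<forall>h. h \<noteq> [] \<and> set h \<subseteq> states N \<longrightarrow> set_pmf (\<pi> h) \<subseteq> {1..N})"

text \<open>
  Joint law of the states in slots \<open>0, \<dots>, t\<close>, for an arbitrary distribution \<open>init\<close> of the state in
  slot \<open>0\<close>. Given the history, the action and the next channel states are drawn independently.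
\<close>

primrec history :: "nat \<Rightarrow> real \<Rightarrow> real \<Rightarrow> state pmf \<Rightarrow> policy \<Rightarrow> nat \<Rightarrow> state list pmf" where
  "history N p10 p01 init \<pi> 0 = map_pmf (\<lambda>s. [s]) init"
| "history N p10 p01 init \<pi> (Suc t) =
     bind_pmf (history N p10 p01 init \<pi> t) (\<lambda>h.
     bind_pmf (\<pi> h) (\<lambda>a.
     bind_pmf (next_channels N p10 p01 (snd (hd h))) (\<lambda>C.
     return_pmf ((a, C) # h))))"

definition departs :: "nat \<Rightarrow> state \<Rightarrow> nat \<Rightarrow> bool" where
  "departs i s a \<longleftrightarrow> fst s = i \<and> snd s i \<and> a = i"

definition expected_departures ::
    "nat \<Rightarrow> real \<Rightarrow> real \<Rightarrow> state pmf \<Rightarrow> policy \<Rightarrow> nat \<Rightarrow> nat \<Rightarrow> real" where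
  "expected_departures N p10 p01 init \<pi> i t =
     measure_pmf.expectation
       (bind_pmf (history N p10 p01 init \<pi> t) (\<lambda>h. map_pmf (\<lambda>a. (hd h, a)) (\<pi> h)))
       (\<lambda>(s, a). of_bool (departs i s a))"

definition average_departures ::
    "nat \<Rightarrow> real \<Rightarrow> real \<Rightarrow> state pmf \<Rightarrow> policy \<Rightarrow> nat \<Rightarrow> nat \<Rightarrow> real" where
  "average_departures N p10 p01 init \<pi> i T =
     (\<Sum>t<T. expected_departures N p10 p01 init \<pi> i t) / real T"

definition has_rate ::
    "nat \<Rightarrow> real \<Rightarrow> real \<Rightarrow> state pmf \<Rightarrow> policy \<Rightarrow> nat \<Rightarrow> real \<Rightarrow> bool" where
  "has_rate N p10 p01 init \<pi> i r \<longleftrightarrow> average_departures N p10 p01 init \<pi> i \<longlonglongrightarrow> r"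

definition gm_action :: "nat \<Rightarrow> state \<Rightarrow> nat" where
  "gm_action N s = (case s of (m, C) \<Rightarrow>
     if C m then m
     else (case find C ([Suc m..<Suc N] @ [1..<m]) of Some j \<Rightarrow> j | None \<Rightarrow> m))"

definition gm_policy :: "nat \<Rightarrow> policy" where
  "gm_policy N h = return_pmf (gm_action N (hd h))"

lemma gm_action_in_range: "s \<in> states N \<Longrightarrow> gm_action N s \<in> {1..N}"
  by (auto simp: gm_action_def states_def find_Some_iff nth_append
        split: option.splits if_splits)

lemma admissible_gm_policy: "admissible N (gm_policy N)"
  unfolding admissible_def gm_policy_def
  using gm_action_in_range by (metis hd_in_set set_return_pmf singletonD subset_eq)

end

theory Submission
  imports Defs
begin

text \<open>
  Why the myopic rule is optimal. In any slot there is at most one departure, and only if the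
  channel at the server's location is ON. Given the past up to slot \<open>t\<close>, this channel is ON in slot
  \<open>t + 1\<close> with probability \<open>1 - p10\<close> if the chosen queue was ON in slot \<open>t\<close>, and with the smaller
  probability \<open>p01\<close> otherwise. Hence, whatever the policy does, the expected number of departures
  in slot \<open>t + 1\<close> is at most \<open>(1 - p10) (1 - q t) + p01 * q t\<close>, where \<open>q t\<close> is the probability that
  all channels are OFF in slot \<open>t\<close> (\<open>sum_expected_departures_le\<close>, \<open>service_prob_le\<close>). The greedy
  myopic policy always chooses an ON queue if there is one, and it never leaves an ON queue, so for
  it both estimates are equalities (\<open>sum_expected_departures_gm\<close>, \<open>service_prob_gm\<close>).

  The channels evolve independently of the actions, so \<open>q\<close> does not depend on the policy. Each
  channel relaxes to its stationary law, and \<open>q t\<close> converges to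
  \<open>C0 = (p10 / (p10 + p01)) ^ N\<close> (\<open>off_prob_tendsto\<close>). Thus the bound tends to
  \<open>(1 - p10) (1 - C0) + p01 * C0 = B\<close>, and its time averages have the same limit.

  This settles the sum of the rates. That every single queue has a rate under the greedy myopic
  policy is a separate matter: under this policy the state is a finite Markov chain, and from every
  state it can reach the state \<open>(1, \<lambda>_. False)\<close> in exactly two steps. A contraction argument
  (\<open>markov_law_convergent\<close>) then shows that the expectation of any function of the state converges.
\<close>

section \<open>Averages of convergent sequences and expectations of finitely supported laws\<close>

text \<open>
  The terms before the sequence is within \<open>e / 2\<close> of its limit contribute a fixed amount \<open>S\<close>, which
  the division by \<open>T\<close> makes negligible.
\<close>

lemma tendsto_average:
  fixes a :: "nat \<Rightarrow> real"
  assumes "a \<longlonglongrightarrow> L"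
  shows "(\<lambda>T. (\<Sum>t<T. a t) / real T) \<longlonglongrightarrow> L"
proof (rule LIMSEQ_I)
  fix e :: real assume e: "e > 0"
  obtain M where M: "\<And>t. t \<ge> M \<Longrightarrow> \<bar>a t - L\<bar> < e / 2"
    using LIMSEQ_D[OF assms, of "e / 2"] e by auto
  define S where "S = (\<Sum>t<M. \<bar>a t - L\<bar>)"
  have S: "S \<ge> 0" unfolding S_def by (intro sum_nonneg) auto
  obtain K :: nat where K: "2 * S / e < real K" using reals_Archimedean2 by blast
  show "\<exists>no. \<forall>T\<ge>no. norm ((\<Sum>t<T. a t) / real T - L) < e"
  proof (intro exI allI impI)
    fix T assume T: "T \<ge> max (Suc M) K"
    have T0: "real T > 0" using T by simp
    have ST: "S < real T * e / 2"
    proof -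
      have "2 * S / e < real T" using K T by linarith
      then show ?thesis using e by (simp add: field_simps)
    qed
    have "(\<Sum>t<T. a t) - real T * L = (\<Sum>t<T. a t - L)"
      by (simp add: sum_subtractf)
    also have "\<bar>\<dots>\<bar> \<le> (\<Sum>t<T. \<bar>a t - L\<bar>)" by (rule sum_abs)
    also have "\<dots> = S + (\<Sum>t=M..<T. \<bar>a t - L\<bar>)"
      unfolding S_def using T by (subst sum.atLeastLessThan_concat[of 0 M T, symmetric, unfolded atLeast0LessThan]) auto
    also have "(\<Sum>t=M..<T. \<bar>a t - L\<bar>) \<le> (\<Sum>t=M..<T. e / 2)"
      by (intro sum_mono) (use M in \<open>auto intro: less_imp_le\<close>)
    also have "\<dots> \<le> real T * e / 2"
      using e T by (simp add: mult_right_mono)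
    finally have "\<bar>(\<Sum>t<T. a t) - real T * L\<bar> < real T * e" using ST by simp
    moreover have "(\<Sum>t<T. a t) / real T - L = ((\<Sum>t<T. a t) - real T * L) / real T"
      using T0 by (simp add: field_simps)
    ultimately show "norm ((\<Sum>t<T. a t) / real T - L) < e"
      using T0 by (simp add: abs_divide pos_divide_less_eq mult.commute)
  qed
qed

lemma expectation_bind_finite:
  fixes f :: "'b \<Rightarrow> real"
  assumes "finite (set_pmf p)" "\<And>x. x \<in> set_pmf p \<Longrightarrow> finite (set_pmf (K x))"
  shows "measure_pmf.expectation (bind_pmf p K) f =
         measure_pmf.expectation p (\<lambda>x. measure_pmf.expectation (K x) f)"
  using assms by (simp add: pmf_expectation_bind[of "set_pmf p"] integral_measure_pmf[of "set_pmf p"])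

lemma expectation_cong_pmf:
  fixes f g :: "'a \<Rightarrow> real"
  assumes "\<And>x. x \<in> set_pmf p \<Longrightarrow> f x = g x"
  shows "measure_pmf.expectation p f = measure_pmf.expectation p g"
  using assms by (intro integral_cong_AE) (auto simp: AE_measure_pmf_iff)

lemma expectation_mono_finite:
  fixes f g :: "'a \<Rightarrow> real"
  assumes "finite (set_pmf p)" "\<And>x. x \<in> set_pmf p \<Longrightarrow> f x \<le> g x"
  shows "measure_pmf.expectation p f \<le> measure_pmf.expectation p g"
  using assms by (intro integral_mono_AE integrable_measure_pmf_finite) (auto simp: AE_measure_pmf_iff)

section \<open>Convergence of finite Markov chains\<close>

primrec markov_law :: "('a \<Rightarrow> 'a pmf) \<Rightarrow> 'a pmf \<Rightarrow> nat \<Rightarrow> 'a pmf" where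
  "markov_law K \<mu> 0 = \<mu>"
| "markov_law K \<mu> (Suc t) = bind_pmf (markov_law K \<mu> t) K"

lemma markov_law_add: "markov_law K \<mu> (m + n) = markov_law K (markov_law K \<mu> m) n"
  by (induction n) auto

text \<open>
  Linearity in the initial law: this turns a statement about all initial laws into one about
  deterministic starts, and expresses the expectation after \<open>n\<close> steps as an average over the
  starting state.
\<close>

lemma markov_law_mixture:
  "markov_law K \<mu> n = bind_pmf \<mu> (\<lambda>s. markov_law K (return_pmf s) n)"
  by (induction n) (auto simp: bind_return_pmf' bind_assoc_pmf)

lemma set_markov_law:
  assumes "\<And>s. s \<in> S \<Longrightarrow> set_pmf (K s) \<subseteq> S" "set_pmf \<mu> \<subseteq> S"
  shows "set_pmf (markov_law K \<mu> n) \<subseteq> S"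
  using assms by (induction n) auto

text \<open>
  An atom of mass at least \<open>\<delta>\<close> at \<open>z\<close> pins a fraction \<open>\<delta>\<close> of the expectation to the value at \<open>z\<close>;
  only the remaining mass \<open>1 - \<delta>\<close> can range over the interval of width \<open>w\<close>. The resulting shorter
  interval depends on \<open>v\<close> but not on \<open>\<nu>\<close>.
\<close>

lemma expectation_bounds_atom:
  fixes v :: "'a \<Rightarrow> real"
  assumes fin: "finite (set_pmf \<nu>)" and \<delta>: "\<delta> \<le> pmf \<nu> z" "0 \<le> \<delta>"
    and v: "\<And>s. s \<in> set_pmf \<nu> \<Longrightarrow> v s \<in> {c..c + w}" "v z \<in> {c..c + w}"
  shows "measure_pmf.expectation \<nu> v \<in> {c + \<delta> * (v z - c)..c + \<delta> * (v z - c) + (1 - \<delta>) * w}"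
proof -
  let ?E = "measure_pmf.expectation \<nu>"
  have int: "integrable (measure_pmf \<nu>) h" for h :: "'a \<Rightarrow> real"
    using fin by (rule integrable_measure_pmf_finite)
  have Ez: "?E (indicator {z}) = pmf \<nu> z"
    by (simp add: pmf.rep_eq)
  have lo: "?E (\<lambda>s. c + (v z - c) * indicator {z} s) = c + (v z - c) * pmf \<nu> z"
    using Ez by (simp add: int)
  have hi: "?E (\<lambda>s. c + w - (c + w - v z) * indicator {z} s) = c + w - (c + w - v z) * pmf \<nu> z"
    using Ez by (simp add: int)
  have "c + (v z - c) * pmf \<nu> z \<le> ?E v"
    unfolding lo[symmetric] using v by (intro expectation_mono_finite fin) (auto simp: indicator_def)
  moreover have "?E v \<le> c + w - (c + w - v z) * pmf \<nu> z"
    unfolding hi[symmetric] using v by (intro expectation_mono_finite fin) (auto simp: indicator_def)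
  moreover have "(v z - c) * \<delta> \<le> (v z - c) * pmf \<nu> z"
    using v \<delta> by (intro mult_left_mono) auto
  moreover have "(c + w - v z) * \<delta> \<le> (c + w - v z) * pmf \<nu> z"
    using v \<delta> by (intro mult_left_mono) auto
  ultimately show ?thesis by (simp add: algebra_simps)
qed

text \<open>
  Doeblin's argument. By finiteness the reachability of \<open>z\<close> in \<open>k\<close> steps has a uniform
  probability \<open>\<delta> > 0\<close>. Every further block of \<open>k\<close> steps then shrinks, by the factor \<open>1 - \<delta>\<close>, an
  interval that contains the expectation of \<open>f\<close> at all later times and for all initial laws.
\<close>

lemma markov_law_convergent:
  fixes f :: "'a \<Rightarrow> real"
  assumes fin: "finite S" and closed: "\<And>s. s \<in> S \<Longrightarrow> set_pmf (K s) \<subseteq> S"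
    and z: "\<And>s. s \<in> S \<Longrightarrow> z \<in> set_pmf (markov_law K (return_pmf s) k)"
    and \<mu>: "set_pmf \<mu> \<subseteq> S"
  shows "convergent (\<lambda>t. measure_pmf.expectation (markov_law K \<mu> t) f)"
proof -
  have S0: "S \<noteq> {}" using \<mu> set_pmf_not_empty[of \<mu>] by auto
  have law: "set_pmf (markov_law K \<nu> n) \<subseteq> S" if "set_pmf \<nu> \<subseteq> S" for \<nu> n
    using set_markov_law[of S K, OF closed that] .
  have fin_law: "finite (set_pmf (markov_law K \<nu> n))" if "set_pmf \<nu> \<subseteq> S" for \<nu> n
    by (rule finite_subset[OF law[OF that] fin])
  have ret: "set_pmf (return_pmf s) \<subseteq> S" if "s \<in> S" for s using that by simp
  have zS: "z \<in> S"
  proof -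
    obtain s where "s \<in> S" using S0 by blast
    then show ?thesis using z[of s] law[OF ret, of s k] by blast
  qed
  define \<delta> where "\<delta> = Min ((\<lambda>s. pmf (markov_law K (return_pmf s) k) z) ` S)"
  have \<delta>_le: "\<delta> \<le> pmf (markov_law K (return_pmf s) k) z" if "s \<in> S" for s
    unfolding \<delta>_def using fin that by auto
  have \<delta>_pos: "\<delta> > 0"
    unfolding \<delta>_def using fin S0 z by (auto simp: pmf_positive)
  have \<delta>_1: "\<delta> \<le> 1" by (rule order_trans[OF \<delta>_le[OF zS] pmf_le_1])
  have atom: "\<delta> \<le> pmf (markov_law K \<nu> j) z" if "set_pmf \<nu> \<subseteq> S" "j \<ge> k" for \<nu> j
  proof -
    have "markov_law K \<nu> j = bind_pmf (markov_law K \<nu> (j - k)) (\<lambda>s. markov_law K (return_pmf s) k)"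
      using that markov_law_add[of K \<nu> "j - k" k] markov_law_mixture[of K "markov_law K \<nu> (j - k)" k] by simp
    moreover have "measure_pmf.expectation (markov_law K \<nu> (j - k)) (\<lambda>_. \<delta>)
        \<le> measure_pmf.expectation (markov_law K \<nu> (j - k)) (\<lambda>s. pmf (markov_law K (return_pmf s) k) z)"
      using law[OF that(1)] fin_law[OF that(1)]
      by (intro expectation_mono_finite) (auto intro: \<delta>_le)
    ultimately show ?thesis by (simp add: pmf_bind)
  qed
  define D where "D = Max ((\<lambda>s. \<bar>f s\<bar>) ` S)"
  have D: "-D \<le> f s" "f s \<le> D" if "s \<in> S" for s
    using Max_ge[OF finite_imageI[OF fin] imageI[OF that], of "\<lambda>s. \<bar>f s\<bar>"] unfolding D_def by auto
  have contraction: "\<exists>c. \<forall>\<nu> j. set_pmf \<nu> \<subseteq> S \<longrightarrow> j \<ge> n * k \<longrightarrow>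
      measure_pmf.expectation (markov_law K \<nu> j) f \<in> {c..c + (1 - \<delta>) ^ n * (2 * D)}" for n
  proof (induction n)
    case 0
    have "measure_pmf.expectation (markov_law K \<nu> j) f \<in> {-D..-D + 2 * D}" if "set_pmf \<nu> \<subseteq> S" for \<nu> j
    proof -
      have "measure_pmf.expectation (markov_law K \<nu> j) (\<lambda>_. -D) \<le> measure_pmf.expectation (markov_law K \<nu> j) f"
        "measure_pmf.expectation (markov_law K \<nu> j) f \<le> measure_pmf.expectation (markov_law K \<nu> j) (\<lambda>_. D)"
        using law[OF that, of j] by (intro expectation_mono_finite fin_law[OF that] D; blast)+
      then show ?thesis by simp
    qed
    then show ?case by (intro exI[of _ "-D"]) auto
  next
    case (Suc n)
    define w where "w = (1 - \<delta>) ^ n * (2 * D)"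
    define v where "v s = measure_pmf.expectation (markov_law K (return_pmf s) (n * k)) f" for s
    obtain c where c: "\<And>\<nu> j. set_pmf \<nu> \<subseteq> S \<Longrightarrow> j \<ge> n * k \<Longrightarrow>
        measure_pmf.expectation (markov_law K \<nu> j) f \<in> {c..c + w}"
      using Suc unfolding w_def by blast
    have v: "v s \<in> {c..c + w}" if "s \<in> S" for s
      unfolding v_def by (rule c[OF ret[OF that] order.refl])
    have "measure_pmf.expectation (markov_law K \<nu> j) f
        \<in> {c + \<delta> * (v z - c)..c + \<delta> * (v z - c) + (1 - \<delta>) * w}"
      if "set_pmf \<nu> \<subseteq> S" "j \<ge> Suc n * k" for \<nu> j
    proof -
      \<comment> \<open>Of the \<open>j\<close> steps, the last \<open>n * k\<close> turn \<open>f\<close> into \<open>v\<close>, and at least \<open>k\<close> earlier ones remain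
        to create the atom at \<open>z\<close>.\<close>
      let ?\<rho> = "markov_law K \<nu> (j - n * k)"
      have \<rho>: "set_pmf ?\<rho> \<subseteq> S" and fin\<rho>: "finite (set_pmf ?\<rho>)"
        using law[OF that(1)] fin_law[OF that(1)] .
      have "markov_law K \<nu> j = bind_pmf ?\<rho> (\<lambda>s. markov_law K (return_pmf s) (n * k))"
        using that markov_law_add[of K \<nu> "j - n * k" "n * k"] markov_law_mixture[of K ?\<rho> "n * k"] by simp
      then have "measure_pmf.expectation (markov_law K \<nu> j) f = measure_pmf.expectation ?\<rho> v"
        unfolding v_def using \<rho> fin\<rho> fin_law[OF ret]
        by (simp only:) (rule expectation_bind_finite, auto)
      moreover have "\<delta> \<le> pmf ?\<rho> z" using that by (intro atom) auto
      ultimately show ?thesis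
        using expectation_bounds_atom[OF fin\<rho> _ less_imp_le[OF \<delta>_pos], of z v c w] \<rho> v zS by auto
    qed
    then show ?case
      by (intro exI[of _ "c + \<delta> * (v z - c)"]) (auto simp: w_def mult.assoc)
  qed
  have "Cauchy (\<lambda>t. measure_pmf.expectation (markov_law K \<mu> t) f)"
  proof (rule metric_CauchyI)
    fix e :: real assume "e > 0"
    have "(\<lambda>n. (1 - \<delta>) ^ n * (2 * D)) \<longlonglongrightarrow> 0"
      using \<delta>_pos \<delta>_1 by (intro tendsto_mult_left_zero LIMSEQ_power_zero) auto
    then have "eventually (\<lambda>n. (1 - \<delta>) ^ n * (2 * D) < e) sequentially"
      using \<open>e > 0\<close> by (rule order_tendstoD(2))
    then obtain n where n: "(1 - \<delta>) ^ n * (2 * D) < e" by (auto simp: eventually_sequentially)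
    obtain c where c: "\<And>j. j \<ge> n * k \<Longrightarrow>
        measure_pmf.expectation (markov_law K \<mu> j) f \<in> {c..c + (1 - \<delta>) ^ n * (2 * D)}"
      using contraction[of n] \<mu> by blast
    show "\<exists>M. \<forall>i\<ge>M. \<forall>j\<ge>M. dist (measure_pmf.expectation (markov_law K \<mu> i) f)
        (measure_pmf.expectation (markov_law K \<mu> j) f) < e"
    proof (intro exI allI impI)
      fix i j assume "i \<ge> n * k" "j \<ge> n * k"
      then show "dist (measure_pmf.expectation (markov_law K \<mu> i) f)
        (measure_pmf.expectation (markov_law K \<mu> j) f) < e"
        using c[of i] c[of j] n by (auto simp: dist_real_def abs_le_iff)
    qed
  qed
  then show ?thesis by (rule Cauchy_convergent)
qed

section \<open>The channel process\<close>

abbreviation channel_states :: "nat \<Rightarrow> (nat \<Rightarrow> bool) set" where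
  "channel_states N \<equiv> {C. \<forall>i. i \<notin> {1..N} \<longrightarrow> \<not> C i}"

lemma finite_channel_states: "finite (channel_states N)"
proof -
  have "channel_states N = PiE_dflt {1..N} False (\<lambda>_. UNIV)"
    by (auto simp: PiE_dflt_def)
  then show ?thesis by (simp add: finite_PiE_dflt)
qed

lemma finite_states: "finite (states N)"
  unfolding states_def by (intro finite_cartesian_product finite_channel_states) simp

lemma set_next_channels_subset: "set_pmf (next_channels N p10 p01 C) \<subseteq> channel_states N"
  unfolding next_channels_def using set_Pi_pmf_subset[of "{1..N}" False] by fastforce

lemma finite_next_channels: "finite (set_pmf (next_channels N p10 p01 C))"
  by (rule finite_subset[OF set_next_channels_subset finite_channel_states])

lemma set_next_channels:
  assumes "p10 \<in> {0<..<1}" "p01 \<in> {0<..<1}"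
  shows "set_pmf (next_channels N p10 p01 C) = channel_states N"
  unfolding next_channels_def using assms
  by (subst set_Pi_pmf) (auto simp: PiE_dflt_def)

lemma expectation_next_channel:
  assumes "p10 \<in> {0<..<1}" "p01 \<in> {0<..<1}" "i \<in> {1..N}"
  shows "measure_pmf.expectation (next_channels N p10 p01 C) (\<lambda>C'. of_bool (C' i)) =
         (if C i then 1 - p10 else p01)"
proof -
  have "measure_pmf.expectation (next_channels N p10 p01 C) (\<lambda>C'. of_bool (C' i) :: real) =
        measure_pmf.expectation (map_pmf (\<lambda>C'. C' i) (next_channels N p10 p01 C)) of_bool"
    by simp
  also have "map_pmf (\<lambda>C'. C' i) (next_channels N p10 p01 C) = bernoulli_pmf (if C i then 1 - p10 else p01)"
    unfolding next_channels_def using assms by (subst Pi_pmf_component) auto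
  finally show ?thesis using assms by simp
qed

definition all_off :: "nat \<Rightarrow> (nat \<Rightarrow> bool) \<Rightarrow> bool" where
  "all_off N C \<longleftrightarrow> (\<forall>i\<in>{1..N}. \<not> C i)"

text \<open>
  The probability, given the channel states \<open>C\<close>, that all channels are OFF \<open>n\<close> slots later: a
  single channel is then ON with probability \<open>q + (1 - p10 - p01) ^ n * (of_bool (C i) - q)\<close>, where
  \<open>q = p01 / (p10 + p01)\<close> is its stationary probability of being ON.
\<close>

definition off_later :: "nat \<Rightarrow> real \<Rightarrow> real \<Rightarrow> nat \<Rightarrow> (nat \<Rightarrow> bool) \<Rightarrow> real" where
  "off_later N p10 p01 n C =
     (\<Prod>i\<in>{1..N}. p10 / (p10 + p01) - (1 - p10 - p01) ^ n * (of_bool (C i) - p01 / (p10 + p01)))"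

lemma off_later_0:
  assumes "p10 + p01 \<noteq> 0"
  shows "off_later N p10 p01 0 C = of_bool (all_off N C)"
proof -
  have "p10 / (p10 + p01) - (of_bool (C i) - p01 / (p10 + p01)) = of_bool (\<not> C i)" for i
    using assms add_divide_distrib[of p10 p01 "p10 + p01"] by (cases "C i") auto
  then show ?thesis
    unfolding off_later_def all_off_def by auto
qed

text \<open>
  The Chapman-Kolmogorov equation for \<open>off_later\<close>. By independence it reduces to one channel, where
  a transition multiplies the deviation from \<open>q\<close> by the second eigenvalue \<open>1 - p10 - p01\<close>.
\<close>

lemma expectation_off_later:
  assumes "p10 \<in> {0<..<1}" "p01 \<in> {0<..<1}" "p10 + p01 < 1"
  shows "measure_pmf.expectation (next_channels N p10 p01 C) (off_later N p10 p01 n) =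
         off_later N p10 p01 (Suc n) C"
proof -
  define \<theta> where "\<theta> = 1 - p10 - p01"
  define q where "q = p01 / (p10 + p01)"
  have q: "0 < q" "q < 1" "p10 / (p10 + p01) = 1 - q" and q01: "p01 = q * (1 - \<theta>)"
    unfolding q_def \<theta>_def using assms by (auto simp: field_simps)
  have \<theta>: "0 < \<theta> ^ n" "\<theta> ^ n \<le> 1"
    unfolding \<theta>_def using assms by (auto intro!: power_le_one)
  have pos: "1 - q - \<theta> ^ n * (of_bool b - q) \<ge> 0" for b
  proof (cases b)
    case True
    have "\<theta> ^ n * (1 - q) \<le> 1 * (1 - q)" using q \<theta> by (intro mult_right_mono) auto
    then show ?thesis using True by simp
  next
    case False
    have "0 \<le> \<theta> ^ n * q" using q \<theta> by simp
    then show ?thesis using False q by simp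
  qed
  have "measure_pmf.expectation (next_channels N p10 p01 C) (off_later N p10 p01 n) =
    (\<Prod>i\<in>{1..N}. measure_pmf.expectation (bernoulli_pmf (if C i then 1 - p10 else p01))
       (\<lambda>b. 1 - q - \<theta> ^ n * (of_bool b - q)))"
    unfolding next_channels_def off_later_def q(3) \<theta>_def[symmetric] q_def[symmetric]
    by (subst expectation_prod_Pi_pmf[symmetric])
       (use pos in \<open>auto intro: integrable_measure_pmf_finite\<close>)
  also have "\<dots> = off_later N p10 p01 (Suc n) C"
    unfolding off_later_def q(3) \<theta>_def[symmetric] q_def[symmetric]
  proof (intro prod.cong refl)
    fix i
    have p10': "p10 = 1 - q - \<theta> * (1 - q)" using q01 by (simp add: \<theta>_def algebra_simps)
    show "measure_pmf.expectation (bernoulli_pmf (if C i then 1 - p10 else p01))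
       (\<lambda>b. 1 - q - \<theta> ^ n * (of_bool b - q)) = 1 - q - \<theta> ^ Suc n * (of_bool (C i) - q)"
    proof (cases "C i")
      case True
      then show ?thesis using assms by simp (simp add: p10' algebra_simps)
    next
      case False
      then show ?thesis using assms by (simp) (simp add: q01 algebra_simps)
    qed
  qed
  finally show ?thesis .
qed

text \<open>
  Defined through the channel chain alone, so that the independence of the policy is visible;
  \<open>expectation_all_off\<close> gives the connection with the controlled process.
\<close>

definition off_prob :: "nat \<Rightarrow> real \<Rightarrow> real \<Rightarrow> state pmf \<Rightarrow> nat \<Rightarrow> real" where
  "off_prob N p10 p01 init t = measure_pmf.expectation
     (markov_law (next_channels N p10 p01) (map_pmf snd init) t) (\<lambda>C. of_bool (all_off N C))"

lemma off_prob_tendsto: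
  assumes p: "p10 \<in> {0<..<1}" "p01 \<in> {0<..<1}" "p10 + p01 < 1"
    and init: "set_pmf init \<subseteq> states N"
  shows "off_prob N p10 p01 init \<longlonglongrightarrow> p10 ^ N / (p10 + p01) ^ N"
proof -
  let ?K = "next_channels N p10 p01" and ?\<mu> = "map_pmf snd init"
  have \<mu>: "set_pmf ?\<mu> \<subseteq> channel_states N" using init unfolding states_def by fastforce
  have fin: "finite (set_pmf (markov_law ?K ?\<mu> t))" for t
    using finite_subset[OF set_markov_law[OF set_next_channels_subset \<mu>] finite_channel_states] .
  \<comment> \<open>Trade slots of the chain for slots of look-ahead, until only the initial law is left.\<close>
  have shift: "measure_pmf.expectation (markov_law ?K ?\<mu> t) (off_later N p10 p01 n) =
      measure_pmf.expectation ?\<mu> (off_later N p10 p01 (n + t))" for t n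
  proof (induction t arbitrary: n)
    case (Suc t)
    have "measure_pmf.expectation (markov_law ?K ?\<mu> (Suc t)) (off_later N p10 p01 n) =
        measure_pmf.expectation (markov_law ?K ?\<mu> t) (off_later N p10 p01 (Suc n))"
      by (simp only: markov_law.simps)
         (subst expectation_bind_finite, simp_all add: fin finite_next_channels expectation_off_later[OF p])
    then show ?case using Suc by (simp only: add_Suc add_Suc_right)
  qed simp
  have off_sum: "off_prob N p10 p01 init t = (\<Sum>C\<in>set_pmf ?\<mu>. off_later N p10 p01 t C * pmf ?\<mu> C)" for t
  proof -
    have "off_prob N p10 p01 init t = measure_pmf.expectation ?\<mu> (off_later N p10 p01 t)"
      using shift[of t 0] p unfolding off_prob_def by (subst off_later_0[symmetric, of p10 p01]) auto
    also have "\<dots> = (\<Sum>C\<in>set_pmf ?\<mu>. off_later N p10 p01 t C * pmf ?\<mu> C)"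
      by (rule integral_measure_pmf_real) (use fin[of 0] in auto)
    finally show ?thesis .
  qed
  have "(\<lambda>t. off_later N p10 p01 t C) \<longlonglongrightarrow>
      (\<Prod>i\<in>{1..N}. p10 / (p10 + p01) - 0 * (of_bool (C i) - p01 / (p10 + p01)))" for C
    unfolding off_later_def using p
    by (intro tendsto_prod tendsto_diff tendsto_const tendsto_mult LIMSEQ_power_zero) auto
  then have "(\<lambda>t. off_later N p10 p01 t C) \<longlonglongrightarrow> p10 ^ N / (p10 + p01) ^ N" for C
    by (simp add: power_divide)
  then have "(\<lambda>t. \<Sum>C\<in>set_pmf ?\<mu>. off_later N p10 p01 t C * pmf ?\<mu> C) \<longlonglongrightarrow>
      (\<Sum>C\<in>set_pmf ?\<mu>. p10 ^ N / (p10 + p01) ^ N * pmf ?\<mu> C)"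
    by (intro tendsto_sum tendsto_mult tendsto_const)
  moreover have "(\<Sum>C\<in>set_pmf ?\<mu>. p10 ^ N / (p10 + p01) ^ N * pmf ?\<mu> C) = p10 ^ N / (p10 + p01) ^ N"
    using sum_pmf_eq_1[of "set_pmf ?\<mu>" ?\<mu>] fin[of 0]
    unfolding sum_distrib_left[symmetric] by simp
  ultimately show ?thesis by (simp only: off_sum[abs_def])
qed

section \<open>Departures in one slot\<close>

text \<open>
  Finiteness of the support makes every function of the history integrable; the invariant
  \<open>set h \<subseteq> states N\<close> is what makes admissibility applicable to the histories that occur.
\<close>

lemma set_history:
  assumes adm: "admissible N \<pi>" and init: "set_pmf init \<subseteq> states N"
  shows "finite (set_pmf (history N p10 p01 init \<pi> t)) \<and>
         (\<forall>h\<in>set_pmf (history N p10 p01 init \<pi> t). h \<noteq> [] \<and> set h \<subseteq> states N)"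
proof (induction t)
  case 0
  then show ?case using init finite_subset[OF init finite_states] by auto
next
  case (Suc t)
  have \<pi>: "set_pmf (\<pi> h) \<subseteq> {1..N}" if "h \<in> set_pmf (history N p10 p01 init \<pi> t)" for h
    using adm Suc that unfolding admissible_def by blast
  then have "finite (set_pmf (\<pi> h))" if "h \<in> set_pmf (history N p10 p01 init \<pi> t)" for h
    using that by (meson finite_atLeastAtMost finite_subset)
  then have "finite (set_pmf (history N p10 p01 init \<pi> (Suc t)))"
    using Suc by (auto intro!: finite_UN_I finite_next_channels)
  moreover have "h \<noteq> [] \<and> set h \<subseteq> states N"
    if hyp: "h \<in> set_pmf (history N p10 p01 init \<pi> (Suc t))" for h
  proof -
    obtain h' a C where h: "h = (a, C) # h'" "h' \<in> set_pmf (history N p10 p01 init \<pi> t)"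
      "a \<in> set_pmf (\<pi> h')" "C \<in> set_pmf (next_channels N p10 p01 (snd (hd h')))"
      using hyp by auto
    have "a \<in> {1..N}" "C \<in> channel_states N"
      using h(3,4) \<pi>[OF h(2)] set_next_channels_subset[of N p10 p01 "snd (hd h')"] by blast+
    then have "(a, C) \<in> states N" by (simp add: states_def)
    then show ?thesis using h Suc by auto
  qed
  ultimately show ?case by blast
qed

text \<open>
  The policy is consulted in every slot, but its choice is discarded when only the channels are
  observed.
\<close>

lemma map_channels_history:
  "map_pmf (\<lambda>h. snd (hd h)) (history N p10 p01 init \<pi> t) =
   markov_law (next_channels N p10 p01) (map_pmf snd init) t"
proof (induction t)
  case 0
  then show ?case by (simp add: pmf.map_comp o_def)
next
  case (Suc t)
  have "map_pmf (\<lambda>h. snd (hd h)) (history N p10 p01 init \<pi> (Suc t)) =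
      bind_pmf (history N p10 p01 init \<pi> t) (\<lambda>h. next_channels N p10 p01 (snd (hd h)))"
    by (simp add: map_bind_pmf bind_return_pmf')
  also have "\<dots> = markov_law (next_channels N p10 p01) (map_pmf snd init) (Suc t)"
    by (simp add: Suc[symmetric] bind_map_pmf)
  finally show ?case .
qed

lemma sum_departs:
  assumes "s \<in> states N"
  shows "(\<Sum>i=1..N. of_bool (departs i s a)) = (of_bool (snd s (fst s) \<and> a = fst s) :: real)"
proof -
  have "(\<Sum>i=1..N. of_bool (departs i s a)) =
      (\<Sum>i=1..N. if i = fst s then of_bool (snd s (fst s) \<and> a = fst s) else 0 :: real)"
    by (intro sum.cong) (auto simp: departs_def)
  also have "\<dots> = of_bool (snd s (fst s) \<and> a = fst s)"
    using assms by (auto simp: sum.delta states_def)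
  finally show ?thesis .
qed

lemma sum_expected_departures:
  assumes adm: "admissible N \<pi>" and init: "set_pmf init \<subseteq> states N"
  shows "(\<Sum>i=1..N. expected_departures N p10 p01 init \<pi> i t) =
    measure_pmf.expectation (history N p10 p01 init \<pi> t) (\<lambda>h.
      measure_pmf.expectation (\<pi> h) (\<lambda>a. of_bool (snd (hd h) (fst (hd h)) \<and> a = fst (hd h))))"
proof -
  let ?H = "history N p10 p01 init \<pi> t"
  have fin: "finite (set_pmf ?H)" and h: "\<And>h. h \<in> set_pmf ?H \<Longrightarrow> h \<noteq> [] \<and> set h \<subseteq> states N"
    using set_history[OF assms] by auto
  have fin\<pi>: "finite (set_pmf (\<pi> h))" if "h \<in> set_pmf ?H" for h
    using adm h[OF that] unfolding admissible_def by (meson finite_atLeastAtMost finite_subset)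
  have "expected_departures N p10 p01 init \<pi> i t = measure_pmf.expectation ?H (\<lambda>h.
      measure_pmf.expectation (\<pi> h) (\<lambda>a. of_bool (departs i (hd h) a)))" for i
    unfolding expected_departures_def
    by (subst expectation_bind_finite) (auto simp: fin fin\<pi>)
  then have "(\<Sum>i=1..N. expected_departures N p10 p01 init \<pi> i t) =
      measure_pmf.expectation ?H (\<lambda>h. \<Sum>i=1..N.
      measure_pmf.expectation (\<pi> h) (\<lambda>a. of_bool (departs i (hd h) a)))"
    using fin by (simp add: Bochner_Integration.integral_sum integrable_measure_pmf_finite)
  also have "\<dots> = measure_pmf.expectation ?H (\<lambda>h.
      measure_pmf.expectation (\<pi> h) (\<lambda>a. of_bool (snd (hd h) (fst (hd h)) \<and> a = fst (hd h))))"
  proof (intro expectation_cong_pmf)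
    fix h assume "h \<in> set_pmf ?H"
    then have "hd h \<in> states N" using h by (metis hd_in_set subsetD)
    then show "(\<Sum>i=1..N. measure_pmf.expectation (\<pi> h) (\<lambda>a. of_bool (departs i (hd h) a))) =
        measure_pmf.expectation (\<pi> h) (\<lambda>a. of_bool (snd (hd h) (fst (hd h)) \<and> a = fst (hd h)) :: real)"
      using fin\<pi>[OF \<open>h \<in> set_pmf ?H\<close>]
      by (subst Bochner_Integration.integral_sum[symmetric])
         (rule integrable_measure_pmf_finite, simp, simp only: sum_departs)
  qed
  finally show ?thesis .
qed

text \<open>
  The probability that the server finds the channel at its location ON, whether or not it then
  stays to serve.
\<close>

definition service_prob :: "nat \<Rightarrow> real \<Rightarrow> real \<Rightarrow> state pmf \<Rightarrow> policy \<Rightarrow> nat \<Rightarrow> real" where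
  "service_prob N p10 p01 init \<pi> t = measure_pmf.expectation (history N p10 p01 init \<pi> t)
     (\<lambda>h. of_bool (snd (hd h) (fst (hd h))))"

lemma sum_expected_departures_le:
  assumes adm: "admissible N \<pi>" and init: "set_pmf init \<subseteq> states N"
  shows "(\<Sum>i=1..N. expected_departures N p10 p01 init \<pi> i t) \<le> service_prob N p10 p01 init \<pi> t"
  unfolding sum_expected_departures[OF assms] service_prob_def
proof (intro expectation_mono_finite)
  fix h assume "h \<in> set_pmf (history N p10 p01 init \<pi> t)"
  then have "finite (set_pmf (\<pi> h))"
    using adm set_history[OF assms, of p10 p01 t] unfolding admissible_def by (meson finite_atLeastAtMost finite_subset)
  then have "measure_pmf.expectation (\<pi> h) (\<lambda>a. of_bool (snd (hd h) (fst (hd h)) \<and> a = fst (hd h)))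
      \<le> measure_pmf.expectation (\<pi> h) (\<lambda>a. of_bool (snd (hd h) (fst (hd h))) :: real)"
    by (intro expectation_mono_finite) auto
  then show "measure_pmf.expectation (\<pi> h) (\<lambda>a. of_bool (snd (hd h) (fst (hd h)) \<and> a = fst (hd h)))
      \<le> (of_bool (snd (hd h) (fst (hd h))) :: real)" by simp
qed (use set_history[OF assms, of p10 p01 t] in simp)

text \<open>
  Leaving an ON queue would waste the slot; the greedy myopic policy never does.
\<close>

lemma sum_expected_departures_gm:
  assumes init: "set_pmf init \<subseteq> states N"
  shows "(\<Sum>i=1..N. expected_departures N p10 p01 init (gm_policy N) i t) =
         service_prob N p10 p01 init (gm_policy N) t"
  unfolding sum_expected_departures[OF admissible_gm_policy init] service_prob_def
  by (intro expectation_cong_pmf) (auto simp: gm_policy_def gm_action_def split: prod.splits)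

text \<open>
  Since the action and the next channel states are drawn independently given the history, the
  server's next success depends on the history only through the present state of the chosen queue.
\<close>

lemma service_prob_Suc:
  assumes p: "p10 \<in> {0<..<1}" "p01 \<in> {0<..<1}"
    and adm: "admissible N \<pi>" and init: "set_pmf init \<subseteq> states N"
  shows "service_prob N p10 p01 init \<pi> (Suc t) =
    measure_pmf.expectation (history N p10 p01 init \<pi> t) (\<lambda>h.
      measure_pmf.expectation (\<pi> h) (\<lambda>a. if snd (hd h) a then 1 - p10 else p01))"
proof -
  let ?H = "history N p10 p01 init \<pi> t"
  have \<pi>: "set_pmf (\<pi> h) \<subseteq> {1..N}" if "h \<in> set_pmf ?H" for h
    using adm set_history[OF adm init, of p10 p01 t] that unfolding admissible_def by blast
  then have fin\<pi>: "finite (set_pmf (\<pi> h))" if "h \<in> set_pmf ?H" for h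
    using that by (meson finite_atLeastAtMost finite_subset)
  have "service_prob N p10 p01 init \<pi> (Suc t) = measure_pmf.expectation ?H (\<lambda>h.
      measure_pmf.expectation (\<pi> h) (\<lambda>a.
        measure_pmf.expectation (next_channels N p10 p01 (snd (hd h))) (\<lambda>C. of_bool (C a))))"
    unfolding service_prob_def history.simps map_pmf_def[symmetric]
    using set_history[OF adm init, of p10 p01 t] fin\<pi> finite_next_channels
    by (subst expectation_bind_finite)
       (auto intro!: expectation_cong_pmf simp: expectation_bind_finite)
  also have "\<dots> = measure_pmf.expectation ?H (\<lambda>h.
      measure_pmf.expectation (\<pi> h) (\<lambda>a. if snd (hd h) a then 1 - p10 else p01))"
    using \<pi> by (intro expectation_cong_pmf expectation_next_channel[OF p]) blast
  finally show ?thesis .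
qed

lemma expectation_all_off:
  assumes adm: "admissible N \<pi>" and init: "set_pmf init \<subseteq> states N"
  shows "measure_pmf.expectation (history N p10 p01 init \<pi> t)
      (\<lambda>h. (1 - p10) - (1 - p10 - p01) * of_bool (all_off N (snd (hd h)))) =
    (1 - p10) - (1 - p10 - p01) * off_prob N p10 p01 init t"
  using set_history[OF assms, of p10 p01 t]
  by (simp add: off_prob_def map_channels_history[symmetric, where \<pi>=\<pi>] integrable_measure_pmf_finite)

text \<open>
  The positive memory \<open>p10 + p01 < 1\<close> enters here: because \<open>p01 < 1 - p10\<close>, the best choice for the
  next slot is a queue that is ON now, and such a queue exists unless all channels are OFF.
\<close>

lemma service_prob_le:
  assumes p: "p10 \<in> {0<..<1}" "p01 \<in> {0<..<1}" "p10 + p01 < 1"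
    and adm: "admissible N \<pi>" and init: "set_pmf init \<subseteq> states N"
  shows "service_prob N p10 p01 init \<pi> (Suc t) \<le> (1 - p10) - (1 - p10 - p01) * off_prob N p10 p01 init t"
  unfolding service_prob_Suc[OF p(1,2) adm init] expectation_all_off[OF adm init, symmetric]
proof (intro expectation_mono_finite)
  fix h assume h: "h \<in> set_pmf (history N p10 p01 init \<pi> t)"
  have \<pi>: "set_pmf (\<pi> h) \<subseteq> {1..N}"
    using adm set_history[OF adm init, of p10 p01 t] h unfolding admissible_def by blast
  then have "finite (set_pmf (\<pi> h))" by (rule finite_subset) simp
  then have "measure_pmf.expectation (\<pi> h) (\<lambda>a. if snd (hd h) a then 1 - p10 else p01) \<le>
      measure_pmf.expectation (\<pi> h) (\<lambda>_. (1 - p10) - (1 - p10 - p01) * of_bool (all_off N (snd (hd h))))"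
    using \<pi> p by (intro expectation_mono_finite) (auto simp: all_off_def)
  then show "measure_pmf.expectation (\<pi> h) (\<lambda>a. if snd (hd h) a then 1 - p10 else p01) \<le>
      (1 - p10) - (1 - p10 - p01) * of_bool (all_off N (snd (hd h)))" by simp
qed (use set_history[OF adm init, of p10 p01 t] in simp)

text \<open>
  The list searched by the policy runs through all queues other than the present one, so the search
  fails only if none of them is ON.
\<close>

lemma gm_action_on:
  assumes "s \<in> states N"
  shows "snd s (gm_action N s) \<longleftrightarrow> \<not> all_off N (snd s)"
proof -
  obtain m C where s: "s = (m, C)" by (cases s)
  have m: "m \<in> {1..N}" using assms s by (simp add: states_def)
  show ?thesis
  proof (cases "C m")
    case True
    then show ?thesis using m by (auto simp: s gm_action_def all_off_def)
  next
    case off: False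
    show ?thesis
    proof (cases "find C ([Suc m..<Suc N] @ [1..<m])")
      case None
      then have none: "\<not> C i" if "i \<in> set ([Suc m..<Suc N] @ [1..<m])" for i
        using that unfolding find_None_iff by blast
      have "\<not> C i" if "i \<in> {1..N}" for i
        using none[of i] that off by (cases i m rule: linorder_cases) (auto simp del: upt_Suc)
      then show ?thesis using off None by (auto simp: s gm_action_def all_off_def)
    next
      case (Some j)
      have "j \<in> set ([Suc m..<Suc N] @ [1..<m])" and "C j"
        using Some unfolding find_Some_iff by (metis nth_mem)+
      then have "j \<in> {1..N}" using m by auto
      then show ?thesis using off Some \<open>C j\<close> by (auto simp: s gm_action_def all_off_def)
    qed
  qed
qed

lemma service_prob_gm:
  assumes p: "p10 \<in> {0<..<1}" "p01 \<in> {0<..<1}" and init: "set_pmf init \<subseteq> states N"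
  shows "service_prob N p10 p01 init (gm_policy N) (Suc t) =
         (1 - p10) - (1 - p10 - p01) * off_prob N p10 p01 init t"
  unfolding service_prob_Suc[OF p admissible_gm_policy init]
    expectation_all_off[OF admissible_gm_policy init, symmetric]
proof (intro expectation_cong_pmf)
  fix h assume "h \<in> set_pmf (history N p10 p01 init (gm_policy N) t)"
  then have "hd h \<in> states N"
    using set_history[OF admissible_gm_policy init] by (metis hd_in_set subsetD)
  then show "measure_pmf.expectation (gm_policy N h) (\<lambda>a. if snd (hd h) a then 1 - p10 else p01) =
      (1 - p10) - (1 - p10 - p01) * of_bool (all_off N (snd (hd h)))"
    by (simp add: gm_policy_def gm_action_on)
qed

section \<open>The Markov chain of the greedy myopic policy\<close>

definition gm_kernel :: "nat \<Rightarrow> real \<Rightarrow> real \<Rightarrow> state \<Rightarrow> state pmf" where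
  "gm_kernel N p10 p01 s = map_pmf (Pair (gm_action N s)) (next_channels N p10 p01 (snd s))"

lemma map_hd_history_gm:
  "map_pmf hd (history N p10 p01 init (gm_policy N) t) = markov_law (gm_kernel N p10 p01) init t"
proof (induction t)
  case 0
  then show ?case by (simp add: pmf.map_comp o_def)
next
  case (Suc t)
  have "map_pmf hd (history N p10 p01 init (gm_policy N) (Suc t)) =
      bind_pmf (history N p10 p01 init (gm_policy N) t) (\<lambda>h. gm_kernel N p10 p01 (hd h))"
    by (simp add: map_bind_pmf gm_policy_def bind_return_pmf gm_kernel_def)
       (simp add: map_pmf_def)
  also have "\<dots> = markov_law (gm_kernel N p10 p01) init (Suc t)"
    by (simp add: Suc[symmetric] bind_map_pmf)
  finally show ?case .
qed

lemma expected_departures_gm: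
  "expected_departures N p10 p01 init (gm_policy N) i t =
   measure_pmf.expectation (markov_law (gm_kernel N p10 p01) init t)
     (\<lambda>s. of_bool (departs i s (gm_action N s)))"
proof -
  have "bind_pmf (history N p10 p01 init (gm_policy N) t)
      (\<lambda>h. map_pmf (\<lambda>a. (hd h, a)) (gm_policy N h)) =
    map_pmf (\<lambda>s. (s, gm_action N s)) (markov_law (gm_kernel N p10 p01) init t)"
    unfolding map_hd_history_gm[symmetric] by (simp add: gm_policy_def pmf.map_comp o_def) (simp add: map_pmf_def)
  then show ?thesis unfolding expected_departures_def by simp
qed

text \<open>
  The two steps that lead from any state to \<open>(1, \<lambda>_. False)\<close>: all channel transitions have positive
  probability, so it is possible that channel \<open>1\<close> is the only ON channel in the next slot. The policy
  then chooses queue \<open>1\<close>, and after that all channels may turn OFF.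
\<close>

lemma convergent_expected_departures_gm:
  assumes N: "N \<ge> 1" and p: "p10 \<in> {0<..<1}" "p01 \<in> {0<..<1}" and init: "set_pmf init \<subseteq> states N"
  shows "convergent (expected_departures N p10 p01 init (gm_policy N) i)"
proof -
  let ?K = "gm_kernel N p10 p01"
  have K: "set_pmf (?K s) = Pair (gm_action N s) ` channel_states N" for s
    unfolding gm_kernel_def by (simp add: set_next_channels[OF p])
  define e1 where "e1 = (\<lambda>i. i = (1::nat))"
  have e1: "e1 \<in> channel_states N" using N by (auto simp: e1_def)
  have closed: "set_pmf (?K s) \<subseteq> states N" if "s \<in> states N" for s
    using gm_action_in_range[OF that] unfolding K by (auto simp: states_def)
  have "(1, \<lambda>_. False) \<in> set_pmf (markov_law ?K (return_pmf s) 2)" if s: "s \<in> states N" for s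
  proof -
    let ?s' = "(gm_action N s, e1)"
    have s': "?s' \<in> states N" using gm_action_in_range[OF s] e1 by (simp add: states_def)
    have "\<not> all_off N e1" using N by (auto simp: all_off_def e1_def)
    then have "gm_action N ?s' = 1"
      using gm_action_on[OF s'] by (simp add: e1_def)
    then have "(1, \<lambda>_. False) \<in> set_pmf (?K ?s')" unfolding K by auto
    moreover have "?s' \<in> set_pmf (?K s)" unfolding K using e1 by blast
    ultimately show ?thesis by (auto simp: numeral_2_eq_2 bind_return_pmf)
  qed
  then show ?thesis
    using markov_law_convergent[OF finite_states closed _ init, where z = "(1, \<lambda>_. False)" and k = 2]
    by (simp add: expected_departures_gm[abs_def])
qed

section \<open>Optimality of the greedy myopic policy\<close>

lemma sum_average_departures:
  "(\<Sum>i=1..N. average_departures N p10 p01 init \<pi> i T) =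
   (\<Sum>t<T. \<Sum>i=1..N. expected_departures N p10 p01 init \<pi> i t) / real T"
  unfolding average_departures_def sum_divide_distrib[symmetric] by (subst sum.swap) simp

theorem theorem7:
  fixes N :: nat and p10 p01 C0 B :: real and init :: "state pmf"
  assumes "N > 1"
    and "p10 \<in> {0<..<1}" and "p01 \<in> {0<..<1}" and "p10 + p01 < 1"
    and "set_pmf init \<subseteq> states N"
    and "C0 = p10 ^ N / (p10 + p01) ^ N"
    and "B = 1 - C0 - (p10 * (1 - C0) - p01 * C0)"
  shows "(\<exists>r. (\<forall>i\<in>{1..N}. has_rate N p10 p01 init (gm_policy N) i (r i)) \<and>
              (\<Sum>i=1..N. r i) = B) \<and>
         (\<forall>\<pi> r. admissible N \<pi> \<and> (\<forall>i\<in>{1..N}. has_rate N p10 p01 init \<pi> i (r i)) \<longrightarrow>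
              (\<Sum>i=1..N. r i) \<le> B) \<and>
         (\<forall>\<pi>. admissible N \<pi> \<longrightarrow>
              limsup (\<lambda>T. ereal (\<Sum>i=1..N. average_departures N p10 p01 init \<pi> i T)) \<le> ereal B)"
proof -
  note p = assms(2-4) and init = assms(5)
  define u where "u t = (1 - p10) - (1 - p10 - p01) * off_prob N p10 p01 init t" for t
  have "u \<longlonglongrightarrow> (1 - p10) - (1 - p10 - p01) * C0"
    unfolding u_def assms(6) by (intro tendsto_intros off_prob_tendsto p init)
  then have u: "u \<longlonglongrightarrow> B" by (simp add: assms(7) algebra_simps)
  have sum_rates: "(\<lambda>T. \<Sum>i=1..N. average_departures N p10 p01 init \<pi> i T) \<longlonglongrightarrow> (\<Sum>i=1..N. r i)"
    if "\<forall>i\<in>{1..N}. has_rate N p10 p01 init \<pi> i (r i)" for \<pi> r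
    using that unfolding has_rate_def by (intro tendsto_sum) auto

  have bound: "\<exists>b. b \<longlonglongrightarrow> B \<and> (\<forall>T. (\<Sum>i=1..N. average_departures N p10 p01 init \<pi> i T) \<le> b T)"
    if adm: "admissible N \<pi>" for \<pi>
  proof -
    \<comment> \<open>The estimate by \<open>u\<close> concerns slot \<open>t + 1\<close>. In slot \<open>0\<close> the expectation depends on the initial
      law, so there it is bounded by itself.\<close>
    define d where "d t = (\<Sum>i=1..N. expected_departures N p10 p01 init \<pi> i t)" for t
    define b where "b = case_nat (d 0) u"
    have "(\<lambda>t. b (Suc t)) \<longlonglongrightarrow> B" using u by (simp add: b_def)
    then have "b \<longlonglongrightarrow> B" by (simp only: filterlim_sequentially_Suc)
    then have "(\<lambda>T. (\<Sum>t<T. b t) / real T) \<longlonglongrightarrow> B" by (rule tendsto_average)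
    moreover have "d t \<le> b t" for t
    proof (cases t)
      case (Suc t')
      then show ?thesis
        using sum_expected_departures_le[OF adm init, of p10 p01 t] service_prob_le[OF p adm init, of t']
        by (simp add: d_def b_def u_def)
    qed (simp add: b_def)
    then have "(\<Sum>t<T. d t) / real T \<le> (\<Sum>t<T. b t) / real T" for T
      by (intro divide_right_mono sum_mono) auto
    ultimately show ?thesis unfolding sum_average_departures d_def by blast
  qed

  have gm: "\<exists>r. (\<forall>i\<in>{1..N}. has_rate N p10 p01 init (gm_policy N) i (r i)) \<and> (\<Sum>i=1..N. r i) = B"
  proof -
    define r where "r i = lim (expected_departures N p10 p01 init (gm_policy N) i)" for i
    have "expected_departures N p10 p01 init (gm_policy N) i \<longlonglongrightarrow> r i" for i
      unfolding r_def convergent_LIMSEQ_iff[symmetric]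
      using convergent_expected_departures_gm[OF _ p(1,2) init] assms(1) by simp
    then have r: "has_rate N p10 p01 init (gm_policy N) i (r i)" for i
      unfolding has_rate_def average_departures_def[abs_def] by (rule tendsto_average)
    have "(\<lambda>t. \<Sum>i=1..N. expected_departures N p10 p01 init (gm_policy N) i (Suc t)) \<longlonglongrightarrow> B"
      unfolding sum_expected_departures_gm[OF init] service_prob_gm[OF p(1,2) init] 
      using u by (simp add: u_def[abs_def])
    then have "(\<lambda>t. \<Sum>i=1..N. expected_departures N p10 p01 init (gm_policy N) i t) \<longlonglongrightarrow> B"
      by (rule LIMSEQ_imp_Suc)
    then have "(\<lambda>T. \<Sum>i=1..N. average_departures N p10 p01 init (gm_policy N) i T) \<longlonglongrightarrow> B"
      unfolding sum_average_departures by (rule tendsto_average)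
    then have "(\<Sum>i=1..N. r i) = B" using sum_rates[of "gm_policy N" r] r LIMSEQ_unique by blast
    then show ?thesis using r by blast
  qed

  have "(\<Sum>i=1..N. r i) \<le> B"
    if "admissible N \<pi>" "\<forall>i\<in>{1..N}. has_rate N p10 p01 init \<pi> i (r i)" for \<pi> r
    using bound[OF that(1)] sum_rates[OF that(2)] by (blast intro: LIMSEQ_le)
  moreover have "limsup (\<lambda>T. ereal (\<Sum>i=1..N. average_departures N p10 p01 init \<pi> i T)) \<le> ereal B"
    if adm: "admissible N \<pi>" for \<pi>
  proof -
    obtain b where b: "b \<longlonglongrightarrow> B" "\<And>T. (\<Sum>i=1..N. average_departures N p10 p01 init \<pi> i T) \<le> b T"
      using bound[OF adm] by blast
    have "limsup (\<lambda>T. ereal (\<Sum>i=1..N. average_departures N p10 p01 init \<pi> i T)) \<le> limsup (\<lambda>T. ereal (b T))"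
      using b(2) by (intro Limsup_mono always_eventually) simp
    also have "\<dots> = ereal B" using b(1) by (intro lim_imp_Limsup) simp_all
    finally show ?thesis .
  qed
  ultimately show ?thesis using gm by blast
qed

end
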